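(* For each integer $k\ge1$ let $S^{(2)}_k=\bigl(S^{(2)}(n+k-1,k)\bigr)_{n\ge1}$ be the sequence of Stirling numbers of the second kind. Then: (i) for $k\in\{1,2\}$ the sequence $S^{(2)}_k$ is realizable; (ii) for every $k\ge3$ the sequence $S^{(2)}_k$ is not realizable, but is almost realizable; (iii) for every $k\ge1$, $\mathrm{Fail}\bigl(S^{(2)}_k\bigr)$ divides $(k-1)!$.
   Context: For $n\ge 1$ and $1\le k\le n$, $S^{(2)}(n,k)$ denotes the Stirling number of the second kind: the number of ways to partition a set with $n$ elements into $k$ non-empty subsets. For $k\ge1$, $S^{(2)}_k$ is the sequence whose $n$-th term ($n\ge1$) is $S^{(2)}(n+k-1,k)$; for example $S^{(2)}_3=(1,6,25,90,\dots)$. For an integer sequence $A=(A_n)_{n\ge1}$ write $(\mu*A)(n)=\sum_{d\mid n}\mu(n/d)A_d$, where $\mu$ is the classical Möbius function. The sequence $A$ is called realizable if either of the following two equivalent conditions holds: (a) there is a map $T\colon X\to X$ on a set $X$ with $A_n=|\{x\in X\mid T^nx=x\}|$ for all $n\ge1$; (b) $A$ satisfies both the Dold condition $n\mid(\mu*A)(n)$ for all $n\ge1$ and the sign condition $(\mu*A)(n)\ge0$ for all $n\ge1$. For a rational number $x$, $\mathrm{Denom}(x)$ denotes the (positive) denominator of $x$ written in lowest terms. For a sequence $A$ of non-negative integers define $$\mathrm{Fail}(A)=\mathrm{lcm}\bigl(\{\mathrm{Denom}\bigl(\tfrac1n(\mu*A)(n)\bigr)\mid n\ge1\}\bigr)$$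 if this is finite, and $\mathrm{Fail}(A)=\infty$ otherwise. The sequence $A$ is called almost realizable if $\mathrm{Fail}(A)<\infty$ and $A$ satisfies the sign condition $(\mu*A)(n)\ge0$ for all $n\ge1$. *)

theory Defs
  imports
    "HOL-Combinatorics.Stirling"
    "HOL-Computational_Algebra.Primes"
    "HOL-Computational_Algebra.Squarefree"
    "HOL-Library.Disjoint_Sets"
    "HOL-Library.Extended_Nat"
begin

text \<open>
  Sequences \<open>(A\<^sub>n)\<close> with \<open>n \<ge> 1\<close> are functions \<open>nat \<Rightarrow> int\<close>; the value at \<open>0\<close> is irrelevant.
\<close>

definition moebius :: "nat \<Rightarrow> int" where
  "moebius n = (if squarefree n then (-1) ^ card (prime_factors n) else 0)"

definition moebius_conv :: "(nat \<Rightarrow> int) \<Rightarrow> nat \<Rightarrow> int" where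
  "moebius_conv A n = (\<Sum>d | d dvd n. moebius (n div d) * A d)"

definition dold_condition :: "(nat \<Rightarrow> int) \<Rightarrow> bool" where
  "dold_condition A \<longleftrightarrow> (\<forall>n\<ge>1. int n dvd moebius_conv A n)"

definition sign_condition :: "(nat \<Rightarrow> int) \<Rightarrow> bool" where
  "sign_condition A \<longleftrightarrow> (\<forall>n\<ge>1. moebius_conv A n \<ge> 0)"

definition realizable :: "(nat \<Rightarrow> int) \<Rightarrow> bool" where
  "realizable A \<longleftrightarrow> dold_condition A \<and> sign_condition A"

definition Denom :: "rat \<Rightarrow> nat" where
  "Denom x = nat (snd (quotient_of x))"

definition fail_denoms :: "(nat \<Rightarrow> int) \<Rightarrow> nat set" where
  "fail_denoms A = {Denom (of_int (moebius_conv A n) / of_nat n) | n. n \<ge> 1}"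

text \<open>
  The library's \<open>Lcm\<close> of an infinite set of naturals is \<open>0\<close>, so the case of an infinite least
  common multiple has to be split off. All denominators are positive, so the least common
  multiple is finite iff there are only finitely many of them.
\<close>

definition Fail :: "(nat \<Rightarrow> int) \<Rightarrow> enat" where
  "Fail A = (if finite (fail_denoms A) then enat (Lcm (fail_denoms A)) else \<infinity>)"

definition almost_realizable :: "(nat \<Rightarrow> int) \<Rightarrow> bool" where
  "almost_realizable A \<longleftrightarrow> Fail A < \<infinity> \<and> sign_condition A"

definition Stirling2_seq :: "nat \<Rightarrow> nat \<Rightarrow> int" where
  "Stirling2_seq k n = int (Stirling (n + k - 1) k)"

text \<open>
  The library defines \<^const>\<open>Stirling\<close> by its recurrence; it does count set partitions.
\<close>

lemma card_partition_on_eq_Stirling: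
  assumes "finite A"
  shows "card {P. partition_on A P \<and> card P = k} = Stirling (card A) k"
  using assms
proof (induction A arbitrary: k rule: finite_induct)
  case empty
  have "{P. P = {} \<and> card P = k} = (if k = 0 then {{} :: 'a set set} else {})" by auto
  then show ?case by (cases k) (simp_all add: partition_on_empty)
next
  case (insert a A)
  define part where "part B j = {P. partition_on B P \<and> card P = j}" for B :: "'a set" and j
  have fin: "finite (part A j)" for j
    unfolding part_def
    by (rule finite_subset[OF _ finitely_many_partition_on[OF insert.hyps(1)]]) auto
  have IH: "card (part A j) = Stirling (card A) j" for j
    using insert.IH by (simp add: part_def)
  have finP: "finite P" if "P \<in> part A j" for P j
    using that insert.hyps(1) finite_elements by (auto simp: part_def)
  have notin: "a \<notin> q" if "P \<in> part A j" "q \<in> P" for P j q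
    using that insert.hyps(2) by (auto simp: part_def partition_on_def)
  show ?case
  proof (cases k)
    case 0
    have "\<not> (partition_on (insert a A) P \<and> card P = 0)" for P
    proof
      assume P: "partition_on (insert a A) P \<and> card P = 0"
      then have "finite P" using finite_elements[of "insert a A" P] insert.hyps(1) by simp
      then show False using P by (auto simp: partition_on_def)
    qed
    then have "{P. partition_on (insert a A) P \<and> card P = 0} = {}" by blast
    then show ?thesis using insert.hyps 0 by (simp only: card.empty card_insert_disjoint Stirling.simps not_False_eq_True)
  next
    case (Suc j)
    define S where "S = Sigma (part A k) (\<lambda>P. P)"
    define f where "f = (\<lambda>(P, q). insert (insert a q) (P - {q}))"
    define X where "X = insert {a} ` part A j"
    have f_part: "f (P, q) \<in> part (insert a A) k - X" if P: "P \<in> part A k" and q: "q \<in> P" for P q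
    proof -
      have un: "\<Union>P = A" and dis: "\<And>r s. r \<in> P \<Longrightarrow> s \<in> P \<Longrightarrow> r \<noteq> s \<Longrightarrow> r \<inter> s = {}"
        and ne: "{} \<notin> P"
        using P by (auto simp: part_def partition_on_def disjoint_def)
      have "partition_on (insert a A) (f (P, q))"
      proof (rule partition_onI)
        show "\<Union>(f (P, q)) = insert a A" using un q by (auto simp: f_def)
        show "{} \<notin> f (P, q)" using ne by (auto simp: f_def)
        show "disjnt r s" if "r \<in> f (P, q)" "s \<in> f (P, q)" "r \<noteq> s" for r s
          using that dis q notin[OF P] unfolding f_def disjnt_def by auto
      qed
      moreover have "insert a q \<notin> P - {q}" using notin[OF P] by blast
      then have "card (f (P, q)) = card P"
        using card_Suc_Diff1[OF finP[OF P] q] finP[OF P]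
        by (simp only: f_def prod.case card_insert_disjoint finite_Diff not_False_eq_True)
      moreover have "f (P, q) \<notin> X"
      proof
        assume "f (P, q) \<in> X"
        then have "{a} \<in> f (P, q)" by (auto simp: X_def)
        then have "q = {} \<or> q = {a} \<or> {a} \<in> P" by (auto simp: f_def)
        then show False using ne q notin[OF P] by auto
      qed
      ultimately show ?thesis using P by (simp add: part_def)
    qed
    have X_part: "X \<subseteq> part (insert a A) k"
    proof
      fix Q assume "Q \<in> X"
      then obtain P where P: "P \<in> part A j" and Q: "Q = insert {a} P" by (auto simp: X_def)
      have d: "disjnt {a} (\<Union>P)" using notin[OF P] by auto
      have na: "{a} \<notin> P" using notin[OF P] by auto
      have "insert a A - {a} = A" using insert.hyps(2) by auto
      then have "partition_on (insert a A) Q"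
        unfolding Q partition_on_insert[OF d] using P by (auto simp: part_def)
      then show "Q \<in> part (insert a A) k"
        using finP[OF P] na P Suc by (auto simp: part_def Q)
    qed
    have onto: "Q \<in> f ` S" if Q: "Q \<in> part (insert a A) k" and QX: "Q \<notin> X" for Q
    proof -
      have un: "\<Union>Q = insert a A" and dis: "\<And>r s. r \<in> Q \<Longrightarrow> s \<in> Q \<Longrightarrow> r \<noteq> s \<Longrightarrow> r \<inter> s = {}"
        and ne: "{} \<notin> Q" and cQ: "card Q = k"
        using Q by (auto simp: part_def partition_on_def disjoint_def)
      have finQ: "finite Q" using Q finite_elements[of "insert a A" Q] insert.hyps(1) by (simp add: part_def)
      obtain p where p: "p \<in> Q" "a \<in> p" using un by blast
      define q where "q = p - {a}"
      have pq: "p = insert a q" "a \<notin> q" using p by (auto simp: q_def)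
      have only: "a \<notin> r" if "r \<in> Q" "r \<noteq> p" for r using dis[OF that(1) p(1) that(2)] p(2) by auto
      have q_ne: "q \<noteq> {}"
      proof
        assume "q = {}"
        then have pa: "p = {a}" using pq by simp
        have "partition_on A (Q - {p})"
        proof (rule partition_onI)
          have "\<Union>(Q - {p}) = \<Union>Q - {a}"
            using only pa by blast
          then show "\<Union>(Q - {p}) = A" using un insert.hyps(2) by auto
          show "{} \<notin> Q - {p}" using ne by auto
          show "disjnt r s" if "r \<in> Q - {p}" "s \<in> Q - {p}" "r \<noteq> s" for r s
            using that dis by (auto simp: disjnt_def)
        qed
        moreover have "card (Q - {p}) = j" using finQ p cQ Suc by simp
        ultimately have "Q - {p} \<in> part A j" by (simp add: part_def)
        moreover have "Q = insert {a} (Q - {p})" using p pa by auto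
        ultimately show False using QX by (auto simp: X_def)
      qed
      define P where "P = insert q (Q - {p})"
      have qr: "q \<inter> r = {}" if "r \<in> Q" "r \<noteq> p" for r
        using dis[OF that(1) p(1) that(2)] by (auto simp: q_def)
      have qn: "q \<notin> Q - {p}" using qr q_ne by fastforce
      have "partition_on A P"
      proof (rule partition_onI)
        have "\<Union>(insert q (Q - {p})) = \<Union>Q - {a}"
          using only p by (auto simp: q_def)
        then show "\<Union>P = A" using un insert.hyps(2) by (auto simp: P_def)
        show "{} \<notin> P" using ne q_ne by (auto simp: P_def)
        show "disjnt r s" if "r \<in> P" "s \<in> P" "r \<noteq> s" for r s
          using that dis[of r s] qr[of r] qr[of s] by (auto simp: disjnt_def P_def)
      qed
      moreover have "card P = k"
        using card_Suc_Diff1[OF finQ p(1)] finQ cQ qn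
        by (simp only: P_def card_insert_disjoint finite_Diff not_False_eq_True)
      ultimately have "(P, q) \<in> S" by (auto simp: S_def part_def P_def)
      moreover have "f (P, q) = Q" using qn p pq by (auto simp: f_def P_def)
      ultimately show ?thesis by force
    qed
    have inj_f: "inj_on f S"
    proof (rule inj_onI)
      fix x y assume "x \<in> S" "y \<in> S" and eq: "f x = f y"
      then obtain P q R r where x: "x = (P, q)" "P \<in> part A k" "q \<in> P"
        and y: "y = (R, r)" "R \<in> part A k" "r \<in> R" by (auto simp: S_def)
      have block: "{s \<in> f (P, q). a \<in> s} = {insert a q}" "{s \<in> f (R, r). a \<in> s} = {insert a r}"
        using notin[OF x(2)] notin[OF y(2)] by (auto simp: f_def)
      then have "insert a q = insert a r" using eq x y by simp
      then have qr: "q = r" using notin[OF x(2,3)] notin[OF y(2,3)] by (metis insert_ident)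
      have rest: "{s \<in> f (P, q). a \<notin> s} = P - {q}" "{s \<in> f (R, r). a \<notin> s} = R - {r}"
        using notin[OF x(2)] notin[OF y(2)] by (auto simp: f_def)
      then have "P - {q} = R - {r}" using eq x y by simp
      then have "P = R" using qr x y by blast
      then show "x = y" using qr x y by simp
    qed
    have inj_X: "inj_on (insert {a}) (part A j)"
    proof (rule inj_onI)
      fix P R assume "P \<in> part A j" "R \<in> part A j" "insert {a} P = insert {a} R"
      moreover have "{a} \<notin> P" "{a} \<notin> R" using notin calculation by blast+
      ultimately show "P = R" by (metis insert_ident)
    qed
    have "part (insert a A) k = f ` S \<union> X"
      using X_part onto f_part by (auto simp: S_def)
    moreover have "f ` S \<inter> X = {}" using f_part by (auto simp: S_def)
    moreover have "finite S" unfolding S_def using fin finP by blast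
    moreover have "finite X" using fin by (simp add: X_def)
    ultimately have "card (part (insert a A) k) = card S + card (part A j)"
      by (simp add: card_Un_disjoint card_image inj_f inj_X X_def)
    also have "card S = (\<Sum>P\<in>part A k. card P)"
      unfolding S_def using fin finP by (simp add: card_SigmaI)
    also have "\<dots> = (\<Sum>P\<in>part A k. k)" by (rule sum.cong) (auto simp: part_def)
    also have "\<dots> = k * Stirling (card A) k" by (simp add: IH)
    finally show ?thesis using insert.hyps Suc by (simp add: part_def[symmetric] IH)
  qed
qed

end

theory Submission
  imports Defs "HOL-Number_Theory.Residues"
begin

text \<open>
  The explicit formula for Stirling numbers writes \<open>(k - 1)!\<close> times the sequence as an integer
  combination of the sequences \<open>j\<^sup>n\<close>, each of which satisfies the Dold condition by
  Euler's theorem; so every denominator divides \<open>(k - 1)!\<close>. For \<open>k \<ge> 2\<close> the sequence at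
  least doubles at each step, which forces the sign condition. Finally, the \<open>n\<close>-th term is
  congruent to \<open>(n - 1 + w) choose w\<close> modulo 2, where \<open>w = (k - 1) div 2\<close>. If \<open>w = 2\<^sup>f u\<close> with
  \<open>u\<close> odd, then the term at \<open>2\<^sup>f\<close> is odd and the one at \<open>2 * 2\<^sup>f\<close> is even, so the Dold
  condition fails at \<open>2 * 2\<^sup>f\<close>.
\<close>

section \<open>Moebius convolution\<close>

lemma moebius_1: "moebius 1 = 1"
  by (simp add: moebius_def)

lemma abs_moebius_le_1: "\<bar>moebius n\<bar> \<le> 1"
  by (simp add: moebius_def)

lemma moebius_prime_mult:
  assumes p: "prime p" and c: "\<not> p dvd c"
  shows "moebius (p * c) = - moebius c"
proof -
  have cop: "coprime p c" using p c by (simp add: prime_imp_coprime)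
  have "c \<noteq> 0" using c by (metis dvd_0_right)
  have "squarefree (p * c) \<longleftrightarrow> squarefree c"
    using squarefree_mult_coprime[OF cop] squarefree_prime[OF p] squarefree_multD(2) by blast
  moreover have "prime_factors (p * c) = insert p (prime_factors c)"
    using p \<open>c \<noteq> 0\<close> by (subst prime_factors_product) (auto simp: prime_prime_factors)
  moreover have "p \<notin> prime_factors c" using c by auto
  ultimately show ?thesis by (simp add: moebius_def)
qed

lemma moebius_conv_alt:
  assumes "n > 0"
  shows "moebius_conv A n = (\<Sum>c | c dvd n. moebius c * A (n div c))"
  unfolding moebius_conv_def
  by (rule sum.reindex_bij_witness[of _ "\<lambda>c. n div c" "\<lambda>c. n div c"]) (use assms in auto)

text \<open>Only squarefree divisors contribute, and these are \<open>c\<close> or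
  \<open>p * c\<close> with \<open>c dvd m\<close>; the sign change of \<open>moebius\<close> under
  multiplication by \<open>p\<close> pairs them into differences. Divisibility by
  \<open>p ^ Suc e\<close> thus reduces to a congruence between \<open>A\<close> at two indices
  differing by a factor \<open>p\<close>.\<close>

lemma moebius_conv_prime_power_mult:
  assumes p: "prime p" and m: "\<not> p dvd m"
  shows "moebius_conv A (p ^ Suc e * m) =
    (\<Sum>c | c dvd m. moebius c * (A (p ^ Suc e * (m div c)) - A (p ^ e * (m div c))))"
proof -
  define n where "n = p ^ Suc e * m"
  define D where "D = {c. c dvd m}"
  have "m > 0" using m by (metis dvd_0_right gr0I)
  then have "n > 0" using p prime_gt_0_nat by (simp add: n_def)
  have finD: "finite D" using \<open>m > 0\<close> by (simp add: D_def)
  have p_dvd: "\<not> p dvd c" if "c \<in> D" for c using that m dvd_trans by (auto simp: D_def)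
  have dvd_m: "c dvd m" if "c dvd n" "\<not> p dvd c" for c
  proof -
    have "coprime c (p ^ Suc e)" using that(2) by (meson coprime_commute coprime_power_right_iff p prime_imp_coprime)
    then show ?thesis using that(1) coprime_dvd_mult_right_iff unfolding n_def by blast
  qed
  have sub: "D \<union> (*) p ` D \<subseteq> {c. c dvd n}"
    by (auto simp: D_def n_def intro: dvd_mult mult_dvd_mono)
  \<comment> \<open>A squarefree divisor not dividing \<open>m\<close> contains \<open>p\<close>
    exactly once, so it already lies in the image of \<open>D\<close>.\<close>
  have zero: "moebius c = 0" if "c dvd n" "c \<notin> D \<union> (*) p ` D" for c
  proof (rule ccontr)
    assume "moebius c \<noteq> 0"
    then have sq: "squarefree c" by (simp add: moebius_def split: if_splits)
    have "p dvd c" using dvd_m that by (auto simp: D_def)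
    then obtain d where d: "c = p * d" by auto
    have "\<not> p dvd d"
    proof
      assume "p dvd d"
      then have "p ^ 2 dvd c" by (simp add: d power2_eq_square)
      then have "p dvd 1" using sq squarefreeD by blast
      then show False using p by simp
    qed
    moreover have "d dvd n" using that(1) d by auto
    ultimately have "d \<in> D" using dvd_m by (simp add: D_def)
    then show False using that(2) d by auto
  qed
  have inj: "inj_on ((*) p) D" using p by (auto simp: inj_on_def)
  have "moebius_conv A n = (\<Sum>c | c dvd n. moebius c * A (n div c))"
    using moebius_conv_alt \<open>n > 0\<close> by blast
  also have "\<dots> = (\<Sum>c\<in>D \<union> (*) p ` D. moebius c * A (n div c))"
    by (rule sum.mono_neutral_right) (use \<open>n > 0\<close> sub zero in auto)
  also have "\<dots> = (\<Sum>c\<in>D. moebius c * A (n div c)) + (\<Sum>c\<in>(*) p ` D. moebius c * A (n div c))"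
    by (rule sum.union_disjoint) (use finD p_dvd dvd_triv_left in blast)+
  also have "(\<Sum>c\<in>(*) p ` D. moebius c * A (n div c)) =
      (\<Sum>c\<in>D. moebius (p * c) * A (n div (p * c)))"
    using inj by (simp add: sum.reindex)
  also have "\<dots> = (\<Sum>c\<in>D. - (moebius c * A (p ^ e * (m div c))))"
  proof (rule sum.cong)
    fix c assume c: "c \<in> D"
    have "n div (p * c) = p ^ e * m div c"
      using p prime_gt_0_nat[OF p] by (simp add: n_def mult.assoc)
    also have "\<dots> = p ^ e * (m div c)" using c by (simp add: D_def div_mult_swap)
    finally show "moebius (p * c) * A (n div (p * c)) = - (moebius c * A (p ^ e * (m div c)))"
      using moebius_prime_mult[OF p p_dvd[OF c]] by simp
  qed simp
  also have "(\<Sum>c\<in>D. moebius c * A (n div c)) = (\<Sum>c\<in>D. moebius c * A (p ^ Suc e * (m div c)))"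
    by (rule sum.cong) (auto simp: n_def D_def div_mult_swap)
  finally show ?thesis
    unfolding n_def[symmetric] D_def[symmetric]
    by (simp add: sum_negf sum_subtractf algebra_simps)
qed

lemma moebius_conv_prime_power:
  assumes "prime p"
  shows "moebius_conv A (p ^ Suc e) = A (p ^ Suc e) - A (p ^ e)"
  using moebius_conv_prime_power_mult[OF assms, of 1 A e] prime_gt_1_nat[OF assms] moebius_1
  by auto

lemma moebius_conv_cmult: "moebius_conv (\<lambda>n. c * A n) n = c * moebius_conv A n"
  by (simp add: moebius_conv_def sum_distrib_left mult_ac)

lemma moebius_conv_sum:
  "moebius_conv (\<lambda>n. \<Sum>j\<in>J. A j n) n = (\<Sum>j\<in>J. moebius_conv (A j) n)"
  unfolding moebius_conv_def sum_distrib_left by (rule sum.swap)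

lemma moebius_conv_cong:
  assumes "n > 0" "\<And>d. d > 0 \<Longrightarrow> A d = B d"
  shows "moebius_conv A n = moebius_conv B n"
  unfolding moebius_conv_def
  by (rule sum.cong) (use assms dvd_pos_nat in auto)

section \<open>The Dold condition\<close>

text \<open>If \<open>p\<close> divides \<open>a\<close>, both powers vanish modulo
  \<open>p ^ Suc e\<close> because \<open>e + 1 \<le> p ^ e\<close>. Otherwise the exponents differ
  by the totient of \<open>p ^ Suc e\<close>, and Euler's theorem applies.\<close>

lemma cong_power_prime_power:
  fixes a p :: nat
  assumes p: "prime p"
  shows "[a ^ p ^ Suc e = a ^ p ^ e] (mod p ^ Suc e)"
proof (cases "p dvd a")
  case True
  have "Suc e \<le> p ^ e" using less_exp[of e] power_mono[OF prime_ge_2_nat[OF p], of e] by linarith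
  then have dvd: "p ^ Suc e dvd a ^ p ^ e"
    using True by (meson dvd_power_same le_imp_power_dvd dvd_trans)
  also have "a ^ p ^ e dvd a ^ p ^ Suc e"
    using prime_ge_1_nat[OF p] by (intro le_imp_power_dvd) simp
  finally show ?thesis using dvd by (simp add: cong_def mod_eq_0_iff_dvd)
next
  case False
  then have "coprime a (p ^ Suc e)"
    by (meson coprime_commute coprime_power_right_iff p prime_imp_coprime)
  then have "[a ^ (p ^ e * (p - 1)) * a ^ p ^ e = 1 * a ^ p ^ e] (mod p ^ Suc e)"
    using euler_theorem totient_prime_power_Suc[OF p] cong_scalar_right by metis
  moreover have "p ^ e * (p - 1) + p ^ e = p ^ Suc e"
    using prime_ge_1_nat[OF p] by (simp add: algebra_simps)
  ultimately show ?thesis by (metis power_add mult_1)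
qed

text \<open>Divisibility by \<open>n\<close> is checked one prime at a time: the congruence for base
  \<open>a ^ d\<close> makes every difference in the paired convolution divisible by the full power
  of \<open>p\<close> in \<open>n\<close>.\<close>

lemma dold_condition_power: "dold_condition (\<lambda>n. int a ^ n)"
  unfolding dold_condition_def
proof (intro allI impI)
  fix n :: nat assume n: "n \<ge> 1"
  define x where "x = moebius_conv (\<lambda>n. int a ^ n) n"
  have "n dvd nat \<bar>x\<bar>"
  \<comment> \<open>\<open>multiplicity p 0\<close> is \<open>0\<close> by convention, so comparing
    multiplicities is meaningful only for nonzero \<open>x\<close>.\<close>
  proof (cases "x = 0")
    case False
    show ?thesis
    proof (rule multiplicity_le_imp_dvd)
      fix p :: nat assume p: "prime p"
      show "multiplicity p n \<le> multiplicity p (nat \<bar>x\<bar>)"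
      proof (cases "multiplicity p n")
        case (Suc e)
        obtain m where m: "n = p ^ Suc e * m" "\<not> p dvd m"
          using multiplicity_decompose'[of n p] n p Suc by (metis not_one_le_zero not_prime_unit)
        have "int (p ^ Suc e) dvd int a ^ (p ^ Suc e * d) - int a ^ (p ^ e * d)" for d
        proof -
          have "[(a ^ d) ^ p ^ Suc e = (a ^ d) ^ p ^ e] (mod p ^ Suc e)"
            by (rule cong_power_prime_power[OF p])
          then have "[int (a ^ (p ^ Suc e * d)) = int (a ^ (p ^ e * d))] (mod int (p ^ Suc e))"
            unfolding power_mult[symmetric] cong_int_iff by (simp add: mult.commute)
          then show ?thesis by (simp add: cong_iff_dvd_diff)
        qed
        then have "int (p ^ Suc e) dvd x"
          unfolding x_def m(1) moebius_conv_prime_power_mult[OF p m(2)]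
          by (intro dvd_sum dvd_mult) blast
        then have "p ^ Suc e dvd nat \<bar>x\<bar>" by (simp add: dvd_nat_abs_iff)
        then show ?thesis unfolding Suc
          using False p by (intro multiplicity_geI) (auto simp: not_prime_unit)
      qed simp
    qed (use n in simp)
  qed simp
  then show "int n dvd x" by simp
qed

section \<open>The sign condition\<close>

lemma sum_le_if_doubling:
  fixes A :: "nat \<Rightarrow> int"
  assumes "\<And>n. n \<ge> 1 \<Longrightarrow> 2 * A n \<le> A (Suc n)" and "A 1 \<ge> 0" and "n \<ge> 1"
  shows "sum A {1..<n} \<le> A n"
  using assms(3)
proof (induction n rule: dec_induct)
  case base
  then show ?case using assms(2) by simp
next
  case (step n)
  then show ?case using assms(1)[of n] by (simp add: sum.atLeastLessThan_Suc)
qed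

text \<open>The divisor \<open>n\<close> contributes \<open>A n\<close> with coefficient 1. The
  proper divisors can subtract at most the sum of all earlier terms, which doubling bounds by
  \<open>A n\<close>.\<close>

lemma sign_condition_if_doubling:
  assumes double: "\<And>n. n \<ge> 1 \<Longrightarrow> 2 * A n \<le> A (Suc n)" and nonneg: "\<And>n. A n \<ge> 0"
  shows "sign_condition A"
  unfolding sign_condition_def
proof (intro allI impI)
  fix n :: nat assume n: "n \<ge> 1"
  define D where "D = {d. d dvd n} - {n}"
  have D: "D \<subseteq> {1..<n}"
    using n by (auto simp: D_def dest: dvd_imp_le dvd_pos_nat intro: Suc_leI le_neq_trans)
  have "moebius_conv A n = A n + (\<Sum>d\<in>D. moebius (n div d) * A d)"
    unfolding moebius_conv_def D_def using n moebius_1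
    by (subst sum.remove[of _ n]) auto
  moreover have "- (\<Sum>d\<in>D. moebius (n div d) * A d) \<le> (\<Sum>d\<in>D. A d)"
    unfolding sum_negf[symmetric]
  proof (rule sum_mono)
    fix d
    have "(- moebius (n div d)) * A d \<le> 1 * A d"
      using abs_moebius_le_1[of "n div d"] nonneg[of d] by (intro mult_right_mono) auto
    then show "- (moebius (n div d) * A d) \<le> A d" by simp
  qed
  moreover have "(\<Sum>d\<in>D. A d) \<le> sum A {1..<n}"
    using D nonneg by (intro sum_mono2) auto
  moreover have "sum A {1..<n} \<le> A n"
    using sum_le_if_doubling[of A n] double nonneg n by blast
  ultimately show "moebius_conv A n \<ge> 0" by linarith
qed

section \<open>The failure\<close>

lemma Denom_dvd:
  assumes n: "n > 0" and dvd: "int n dvd int c * x"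
  shows "Denom (of_int x / of_nat n) dvd c"
proof -
  obtain a q where aq: "quotient_of (of_int x / of_nat n) = (a, q)" by fastforce
  have q: "q > 0" using quotient_of_denom_pos[OF aq] .
  have cop: "coprime a q" using quotient_of_coprime[OF aq] .
  have "(of_int x / of_nat n :: rat) = of_int a / of_int q" using quotient_of_div[OF aq] .
  then have "(of_int (q * x) :: rat) = of_int (a * int n)"
    using n q by (simp add: field_simps)
  then have qx: "q * x = a * int n" by (simp only: of_int_eq_iff)
  obtain t where t: "int c * x = int n * t" using dvd by blast
  have "int n * (int c * a) = int c * (q * x)" unfolding qx by simp
  also have "\<dots> = q * (int c * x)" by simp
  also have "\<dots> = int n * (q * t)" unfolding t by simp
  finally have "int c * a = q * t" using n by simp
  then have "q dvd int c * a" by simp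
  then have "q dvd int c" using cop by (simp add: coprime_dvd_mult_left_iff coprime_commute)
  then show ?thesis using q by (simp add: Denom_def aq nat_dvd_iff)
qed

text \<open>A multiplier \<open>c\<close> uniform in \<open>n\<close> confines all denominators to
  the finitely many divisors of \<open>c\<close>, which rules out the infinite case of
  \<open>Fail\<close>.\<close>

lemma Fail_dvd:
  assumes c: "c > 0" and "\<And>n. n \<ge> 1 \<Longrightarrow> int n dvd int c * moebius_conv A n"
  shows "\<exists>m. Fail A = enat m \<and> m dvd c"
proof -
  have dvd: "\<forall>d\<in>fail_denoms A. d dvd c"
    using assms Denom_dvd by (auto simp: fail_denoms_def)
  then have "fail_denoms A \<subseteq> {d. d dvd c}" by blast
  then have "finite (fail_denoms A)" using c finite_subset by fastforce
  moreover have "Lcm (fail_denoms A) dvd c" using dvd by (simp add: Lcm_dvd_iff)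
  ultimately show ?thesis by (simp add: Fail_def)
qed

section \<open>Stirling numbers\<close>

text \<open>This is the usual formula for \<open>k! * Stirling n k\<close> with
  \<open>k = Suc i\<close>, \<open>n = Suc m\<close>, divided by \<open>k\<close> through the
  absorption identity for binomials. The cancelled factor is what gives the bound
  \<open>(k - 1)!\<close> instead of \<open>k!\<close>.\<close>

lemma fact_mult_Stirling:
  "int (fact i * Stirling (Suc m) (Suc i)) =
    (\<Sum>j\<le>i. (-1) ^ (i - j) * int (i choose j) * int (Suc j) ^ m)"
proof (induction m arbitrary: i)
  case 0
  show ?case
  proof (cases "i = 0")
    case False
    have "(\<Sum>j\<le>i. (-1) ^ (i - j) * int (i choose j)) = (\<Sum>j\<le>i. (-1) ^ j * int (i choose j))"
      by (rule sum.reindex_bij_witness[of _ "\<lambda>j. i - j" "\<lambda>j. i - j"])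
        (auto simp: binomial_symmetric[symmetric])
    then show ?thesis using choose_alternating_sum[of i, where 'a=int] False by simp
  qed simp
next
  case (Suc m)
  note IH = Suc.IH
  show ?case
  proof (cases i)
    case 0
    then show ?thesis using Stirling_1[of "Suc m"] by (simp del: Stirling_1 Stirling.simps)
  next
    case (Suc i')
    have companion: "int (i - j) * int (i choose j) = int i * int (i' choose j)" for j
      using binomial_absorb_comp[of i j] Suc by (metis diff_Suc_1 of_nat_mult)
    have "(\<Sum>j\<le>i. (-1) ^ (i - j) * int (i choose j) * int (Suc j) ^ Suc m) =
        (\<Sum>j\<le>i. int (Suc i) * ((-1) ^ (i - j) * int (i choose j) * int (Suc j) ^ m)
          - int i * ((-1) ^ (i - j) * int (i' choose j) * int (Suc j) ^ m))"
    proof (rule sum.cong)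
      fix j assume "j \<in> {..i}"
      \<comment> \<open>Splitting one factor of the power this way mirrors the two terms of the
        Stirling recurrence; \<open>companion\<close> turns the part with \<open>i - j\<close> into
        the sum for \<open>i'\<close>.\<close>
      then have j: "int (Suc j) = int (Suc i) - int (i - j)" by auto
      have "(-1) ^ (i - j) * int (i choose j) * int (Suc j) ^ Suc m =
          int (Suc j) * ((-1) ^ (i - j) * int (i choose j) * int (Suc j) ^ m)"
        by simp
      also have "\<dots> = int (Suc i) * ((-1) ^ (i - j) * int (i choose j) * int (Suc j) ^ m)
          - (-1) ^ (i - j) * (int (i - j) * int (i choose j)) * int (Suc j) ^ m"
        by (subst (1) j) (simp only: algebra_simps)
      finally show "(-1) ^ (i - j) * int (i choose j) * int (Suc j) ^ Suc m =
          int (Suc i) * ((-1) ^ (i - j) * int (i choose j) * int (Suc j) ^ m)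
          - int i * ((-1) ^ (i - j) * int (i' choose j) * int (Suc j) ^ m)"
        unfolding companion by (simp only: mult_ac)
    qed simp
    also have "\<dots> = int (Suc i) * (\<Sum>j\<le>i. (-1) ^ (i - j) * int (i choose j) * int (Suc j) ^ m)
        - int i * (\<Sum>j\<le>i. (-1) ^ (i - j) * int (i' choose j) * int (Suc j) ^ m)"
      by (simp only: sum_subtractf sum_distrib_left)
    \<comment> \<open>The term \<open>j = i\<close> drops out since \<open>i' choose i\<close> is
      0.\<close>
    also have "(\<Sum>j\<le>i. (-1) ^ (i - j) * int (i' choose j) * int (Suc j) ^ m) =
        (\<Sum>j\<le>i'. (-1) ^ (i - j) * int (i' choose j) * int (Suc j) ^ m)"
      by (simp add: Suc)
    also have "\<dots> = - (\<Sum>j\<le>i'. (-1) ^ (i' - j) * int (i' choose j) * int (Suc j) ^ m)"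
      unfolding sum_negf[symmetric] by (rule sum.cong) (auto simp: Suc Suc_diff_le)
    finally show ?thesis
      unfolding IH[symmetric] by (simp add: Suc algebra_simps)
  qed
qed

lemma dvd_fact_mult_moebius_conv_Stirling2_seq:
  assumes k: "k \<ge> 1" and n: "n \<ge> 1"
  shows "int n dvd fact (k - 1) * moebius_conv (Stirling2_seq k) n"
proof -
  define i where "i = k - 1"
  \<comment> \<open>The explicit formula has exponent \<open>d + i - 1\<close>; the part
    \<open>i - 1\<close> independent of \<open>d\<close> goes into the coefficient, leaving the pure
    power sequence of \<open>Suc j\<close>.\<close>
  define c where "c j = (-1) ^ (i - j) * int (i choose j) * int (Suc j) ^ (i - 1)" for j
  have ki: "k = Suc i" using k by (simp add: i_def)
  have seq: "fact i * Stirling2_seq k d = (\<Sum>j\<le>i. c j * int (Suc j) ^ d)" if "d > 0" for d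
  proof -
    have "fact i * Stirling2_seq k d = int (fact i * Stirling (Suc (d + i - 1)) (Suc i))"
      using that by (simp add: Stirling2_seq_def ki)
    also have "\<dots> = (\<Sum>j\<le>i. (-1) ^ (i - j) * int (i choose j) * int (Suc j) ^ (d + i - 1))"
      by (rule fact_mult_Stirling)
    also have "\<dots> = (\<Sum>j\<le>i. c j * int (Suc j) ^ d)"
    \<comment> \<open>For \<open>i = 0\<close> truncated subtraction breaks the splitting of the
      exponent, but then the only base is 1.\<close>
    proof (cases "i = 0")
      case False
      then have "d + i - 1 = (i - 1) + d" by simp
      then show ?thesis by (simp only: c_def power_add mult.assoc)
    qed (simp add: c_def)
    finally show ?thesis .
  qed
  have "fact i * moebius_conv (Stirling2_seq k) n =
      moebius_conv (\<lambda>d. fact i * Stirling2_seq k d) n"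
    by (simp add: moebius_conv_cmult)
  also have "\<dots> = moebius_conv (\<lambda>d. \<Sum>j\<le>i. c j * int (Suc j) ^ d) n"
    by (rule moebius_conv_cong) (use n seq in auto)
  also have "\<dots> = (\<Sum>j\<le>i. c j * moebius_conv (\<lambda>d. int (Suc j) ^ d) n)"
    by (simp only: moebius_conv_sum moebius_conv_cmult)
  finally show ?thesis
    using dold_condition_power n unfolding dold_condition_def i_def[symmetric]
    by (metis (no_types, lifting) dvd_sum dvd_mult)
qed

lemma Stirling2_seq_Suc:
  assumes "n \<ge> 1"
  shows "Stirling2_seq (Suc k) (Suc n) =
    int (Suc k) * Stirling2_seq (Suc k) n + Stirling2_seq k (Suc n)"
  using assms by (cases n) (simp_all add: Stirling2_seq_def algebra_simps)

lemma Stirling2_seq_1: "Stirling2_seq k 1 = 1"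
  by (simp add: Stirling2_seq_def)

lemma Stirling2_seq_one: "n \<ge> 1 \<Longrightarrow> Stirling2_seq 1 n = 1"
  using Stirling_1[of "n - 1"] by (simp add: Stirling2_seq_def del: Stirling_1)

lemma Stirling2_seq_nonneg: "Stirling2_seq k n \<ge> 0"
  by (simp add: Stirling2_seq_def)

text \<open>For \<open>k \<ge> 2\<close> the factor \<open>k\<close> in the recurrence supplies the
  doubling. The constant sequence for \<open>k = 1\<close> does not double, but its convolution is 1
  at \<open>n = 1\<close> and 0 elsewhere.\<close>

lemma sign_condition_Stirling2_seq:
  assumes "k \<ge> 1"
  shows "sign_condition (Stirling2_seq k)"
proof (cases "k = 1")
  case True
  have "moebius_conv (Stirling2_seq 1) n \<ge> 0" if n: "n \<ge> 1" for n
  proof (cases "n = 1")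
    case True
    then show ?thesis using moebius_1 Stirling2_seq_1[of 1] by (simp add: moebius_conv_def)
  next
    case False
    then obtain p where p: "prime p" "p dvd n" using prime_factor_nat by blast
    obtain m where m: "n = p ^ multiplicity p n * m" "\<not> p dvd m"
      using multiplicity_decompose'[of n p] n p by (metis not_one_le_zero not_prime_unit)
    have "multiplicity p n \<noteq> 0"
      using p n m by (metis mult_1 power_0)
    then obtain e where e: "n = p ^ Suc e * m" using m(1) by (metis not0_implies_Suc)
    have "p > 0" using p prime_gt_0_nat by simp
    have "m div c > 0" if "c dvd m" for c
      using that m(2) by (metis dvd_0_right dvd_mult_div_cancel gr0I mult_0_right)
    then have "moebius_conv (Stirling2_seq 1) n = 0"
      unfolding e moebius_conv_prime_power_mult[OF p(1) m(2)] using \<open>p > 0\<close>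
      by (intro sum.neutral) (auto simp: Stirling2_seq_one[unfolded One_nat_def] Suc_le_eq)
    then show ?thesis by simp
  qed
  then show ?thesis using True by (simp add: sign_condition_def)
next
  case False
  then obtain i where k: "k = Suc i" "i \<ge> 1" using assms by (cases k) auto
  show ?thesis
  proof (rule sign_condition_if_doubling)
    fix n :: nat assume n: "n \<ge> 1"
    have "2 * Stirling2_seq k n \<le> int (Suc i) * Stirling2_seq k n"
      using k Stirling2_seq_nonneg by (intro mult_right_mono) auto
    then show "2 * Stirling2_seq k n \<le> Stirling2_seq k (Suc n)"
      using Stirling2_seq_Suc[OF n, of i] Stirling2_seq_nonneg[of i "Suc n"] k by simp
  qed (rule Stirling2_seq_nonneg)
qed

section \<open>Parity\<close>

text \<open>Modulo 2 the generating function, the product of \<open>1 / (1 - j x)\<close> over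
  \<open>j\<close> from 1 to \<open>Suc i\<close>, keeps only its \<open>i div 2 + 1\<close> odd
  factors. In the induction, even \<open>i\<close> yields Pascal's rule, while odd \<open>i\<close>
  copies the parity from \<open>i - 1\<close>.\<close>

lemma even_Stirling2_seq_iff:
  "even (Stirling2_seq (Suc i) (Suc n)) \<longleftrightarrow> even ((n + i div 2) choose (i div 2))"
proof (induction "n + i" arbitrary: n i rule: less_induct)
  case less
  consider "i = 0" | "n = 0" | i' n' where "i = Suc i'" "n = Suc n'"
    by (meson not0_implies_Suc)
  then show ?case
  proof cases
    case 1
    then show ?thesis using Stirling2_seq_one[of "Suc n"] by simp
  next
    case 2
    then show ?thesis using Stirling2_seq_1[of "Suc i"] by simp
  next
    case 3
    have rec: "Stirling2_seq (Suc i) (Suc n) =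
        int (Suc i) * Stirling2_seq (Suc i) (Suc n') + Stirling2_seq (Suc i') (Suc n)"
      using Stirling2_seq_Suc[of "Suc n'" i] 3 by simp
    note IH1 = less[of n' i] and IH2 = less[of n i']
    show ?thesis
    proof (cases "even i")
      case True
      then obtain w where w: "i = 2 * Suc w"
        using 3 by (metis dvd_mult_div_cancel mult_0_right nat.distinct(1) not0_implies_Suc)
      then have "i' div 2 = w" "i div 2 = Suc w" using 3 by simp_all
      then show ?thesis using rec IH1 IH2 3(2) True \<open>i = Suc i'\<close> by auto
    next
      case False
      then have "i' div 2 = i div 2" using 3 by (metis even_Suc even_Suc_div_two)
      then show ?thesis using rec IH2 3 False by simp
    qed
  qed
qed

text \<open>Coefficients of \<open>(1 + x) ^ (2 * a)\<close>, which equals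
  \<open>(1 + x\<^sup>2) ^ a\<close> modulo 2.\<close>

lemma even_binomial_double:
  "(even ((2 * a) choose (2 * b)) \<longleftrightarrow> even (a choose b)) \<and>
   even ((2 * a) choose Suc (2 * b))"
proof (induction a arbitrary: b)
  case 0
  then show ?case by (cases b) auto
next
  case (Suc a)
  have "2 * Suc a = Suc (Suc (2 * a))" by simp
  moreover have "even ((2 * a) choose (2 * b)) \<longleftrightarrow> even (a choose b)"
    "even ((2 * a) choose Suc (2 * b))" for b using Suc by auto
  moreover have "even (2 * a choose Suc (Suc (2 * b))) \<longleftrightarrow> even (a choose Suc b)"
    "even (2 * a choose Suc (Suc (Suc (2 * b))))" for b
    using Suc[of "Suc b"] by auto
  ultimately show ?case by (cases b) auto
qed

lemma even_binomial_odd_even: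
  "even (Suc (2 * a) choose (2 * b)) \<longleftrightarrow> even (a choose b)"
proof (cases b)
  case (Suc c)
  then show ?thesis
    using even_binomial_double[of a b] even_binomial_double[of a c] by simp
qed simp

text \<open>The upper entry is \<open>2 ^ f * (a + w) + (2 ^ f - 1)\<close>, so its low
  \<open>f\<close> bits are all 1 while those of the lower entry are all 0. Each induction step
  strips one such pair of bits.\<close>

lemma even_binomial_power2_shift:
  "even ((2 ^ f * Suc a - 1 + 2 ^ f * w) choose (2 ^ f * w)) \<longleftrightarrow> even ((a + w) choose w)"
proof (induction f)
  case (Suc f)
  have "2 ^ f * Suc a \<noteq> 0" by simp
  then have "2 ^ Suc f * Suc a - 1 + 2 ^ Suc f * w = Suc (2 * (2 ^ f * Suc a - 1 + 2 ^ f * w))"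
    unfolding power_Suc mult.assoc by (cases "2 ^ f * Suc a") (auto simp: algebra_simps)
  moreover have "2 ^ Suc f * w = 2 * (2 ^ f * w)" by simp
  ultimately show ?case using Suc even_binomial_odd_even by metis
qed simp

lemma not_realizable_Stirling2_seq:
  assumes "k \<ge> 3"
  shows "\<not> realizable (Stirling2_seq k)"
proof
  assume "realizable (Stirling2_seq k)"
  then have dold: "dold_condition (Stirling2_seq k)" by (simp add: realizable_def)
  define i where "i = k - 1"
  have k: "k = Suc i" using assms by (simp add: i_def)
  \<comment> \<open>Here \<open>k \<ge> 3\<close> enters: a nonzero number has an odd part.\<close>
  have "i div 2 \<noteq> 0" using assms by (simp add: i_def)
  then obtain u where u: "i div 2 = 2 ^ multiplicity 2 (i div 2) * u" "odd u"
    using multiplicity_decompose'[of "i div 2" 2] by auto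
  define f where "f = multiplicity 2 (i div 2)"
  have w: "i div 2 = 2 ^ f * u" using u f_def by simp
  have parity: "even (Stirling2_seq k (2 ^ f * Suc a)) \<longleftrightarrow> even ((a + u) choose u)" for a
    using even_Stirling2_seq_iff[of i "2 ^ f * Suc a - 1"] even_binomial_power2_shift[of f a u]
    by (simp add: k w)
  \<comment> \<open>The binomials for \<open>a = 0\<close> and \<open>a = 1\<close> are 1 and
    \<open>u + 1\<close>, and \<open>u\<close> is odd.\<close>
  have "odd (Stirling2_seq k (2 ^ f))" using parity[of 0] by simp
  moreover have "even (Stirling2_seq k (2 ^ Suc f))"
    using parity[of 1] u(2) by (simp add: mult_2)
  ultimately have "odd (moebius_conv (Stirling2_seq k) (2 ^ Suc f))"
    by (subst moebius_conv_prime_power) auto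
  moreover have "int (2 ^ Suc f) dvd moebius_conv (Stirling2_seq k) (2 ^ Suc f)"
    using dold unfolding dold_condition_def by (meson one_le_numeral one_le_power)
  ultimately show False
    by (metis dvd_trans dvd_triv_left of_nat_mult of_nat_numeral power_Suc)
qed

theorem theorem7:
  shows "(\<forall>k\<in>{1, 2}. realizable (Stirling2_seq k)) \<and>
    (\<forall>k\<ge>3. \<not> realizable (Stirling2_seq k) \<and> almost_realizable (Stirling2_seq k)) \<and>
    (\<forall>k\<ge>1. \<exists>m. Fail (Stirling2_seq k) = enat m \<and> m dvd fact (k - 1))"
proof -
  have Fail: "\<exists>m. Fail (Stirling2_seq k) = enat m \<and> m dvd fact (k - 1)" if "k \<ge> 1" for k
    by (rule Fail_dvd) (use dvd_fact_mult_moebius_conv_Stirling2_seq[OF that] in auto)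
  have "realizable (Stirling2_seq k)" if "k \<in> {1, 2}" for k
  proof -
    \<comment> \<open>Since \<open>0! = 1! = 1\<close>, the general divisibility is already the Dold
      condition.\<close>
    have "k \<ge> 1" "fact (k - 1) = (1 :: int)" using that by auto
    then show ?thesis
      using dvd_fact_mult_moebius_conv_Stirling2_seq[of k] sign_condition_Stirling2_seq[of k]
      by (simp add: realizable_def dold_condition_def)
  qed
  moreover have "almost_realizable (Stirling2_seq k)" if "k \<ge> 3" for k
    using Fail[of k] sign_condition_Stirling2_seq[of k] that
    by (auto simp: almost_realizable_def)
  ultimately show ?thesis using Fail not_realizable_Stirling2_seq by blast
qed

end
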